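(* Let $n\ge2$, let $A=\{p_1,\dots,p_m\}$ be a finite subset of $\mathbb{R}^n$, let $F\in\mathcal{F}^1(A)$ and assume $\kappa:=\Gamma^1(F;A)>0$. Let $W^+(F,A,\kappa)$ and $W^-(F,A,\kappa)$ be the 1-fields on $\mathbb{R}^n$ associated to Wells' functions $w^+(F,A,\kappa)$ and $w^-(F,A,\kappa)$. Then $W^+(F,A,\kappa)$ and $W^-(F,A,\kappa)$ are absolutely minimal Lipschitz extensions of $F$ on $\mathbb{R}^n$.
   Context: $\mathbb{R}^n$ carries the standard scalar product and Euclidean norm. A 1-field on a nonempty set $\Omega\subset\mathbb{R}^n$ is a map $F$ assigning to each $x\in \Omega$ the polynomial $F(x)(a)=f_x+\langle D_xf,a-x\rangle$ ($a\in\mathbb{R}^n$), where $f_x\in\mathbb{R}$ and $D_xf\in\mathbb{R}^n$. For $x\ne y$ in $\Omega$, $\Gamma^1(F;x,y)=2\sup_{a\in\mathbb{R}^n}\frac{|F(x)(a)-F(y)(a)|}{\|x-a\|^2+\|y-a\|^2}$, and for $S\subset\Omega$, $\Gamma^1(F;S)=\sup_{x\ne y\in S}\Gamma^1(F;x,y)$. $\mathcal{F}^1(\Omega)$ is the set of 1-fields on $\Omega$ with $\Gamma^1(F;\Omega)<+\infty$. The 1-field associated to a $C^1$ function $w$ on $\mathbb{R}^n$ is $W(x)(a)=w(x)+\langle\nabla w(x),a-x\rangle$. For $\Omega_1\subset\Omega_2$ and $F\in\mathcal{F}^1(\Omega_1)$, $G\in\mathcal{F}^1(\Omega_2)$ is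 a minimal Lipschitz extension (MLE) of $F$ on $\Omega_2$ if $G(x)=F(x)$ for $x\in\Omega_1$ and $\Gamma^1(G;\Omega_2)=\Gamma^1(F;\Omega_1)$. $G$ is an absolutely minimal Lipschitz extension (AMLE) of $F$ on $\Omega_2$ if it is an MLE of $F$ on $\Omega_2$ and $\Gamma^1(G;V)=\Gamma^1(G;\partial V)$ for every nonempty bounded open $V$ with $\overline V\subset\Omega_2\setminus\Omega_1$. Wells' construction, for $A$ finite, $F\in\mathcal{F}^1(A)$, $\kappa\ge\Gamma^1(F;A)$, $\kappa>0$. For $p\in A$ set $$\widetilde p^{\pm}=p\mp D_pf/\kappa,\qquad d_p^{\pm}(x)=f_p\mp\tfrac{1}{2\kappa}\|D_pf\|^2\pm\tfrac{\kappa}{4}\|x-\widetilde p^{\pm}\|^2 .$$ For $\emptyset\neq S\subset A$ set $d_S^+(x)=\inf_{p\in S}d_p^+(x)$, $d_S^-(x)=\sup_{p\in S}d_p^-(x)$ (with $\inf\emptyset=+\infty$, $\sup\emptyset=-\infty$ when the index set $A\setminus S$ is empty); $\widetilde S^\pm=\{\widetilde p^\pm:p\in S\}$; $\widehat S^\pm$ = convex hull of $\widetilde S^\pm$; $S_H^\pm$ = smallest affine subspace containing $\widetilde S^\pm$; $S_E^\pm=\{x: d_p^\pm(x)=d_{p'}^\pm(x)\ \forall p,p'\in S\}$; $$S_*^+=\{x:d_p^+(x)=d_{p'}^+(x)\le d_{p''}^+(x)\ \forall p,p'\in S,\ p''\in A\},$$ $$S_*^-=\{x:d_p^-(x)=d_{p'}^-(x)\ge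 d_{p''}^-(x)\ \forall p,p'\in S,\ p''\in A\};$$ $K^+$ = set of those $S$ for which there is $x\in S_*^+$ with $d_S^+(x)<d_{A\setminus S}^+(x)$; $K^-$ = set of those $S$ for which there is $x\in S_*^-$ with $d_S^-(x)>d_{A\setminus S}^-(x)$. For $S\in K^\pm$, $S_C^\pm=S_E^\pm\cap S_H^\pm$ is a single point, and $T_S^\pm=\{\frac12(y+z):y\in\widehat S^\pm,\ z\in S_*^\pm\}$. The sets $T_S^\pm$, $S\in K^\pm$, cover $\mathbb{R}^n$ and have pairwise disjoint interiors. With $d(x,\cdot)$ the Euclidean distance to a set, put for $x\in T_S^\pm$ $$w^\pm(F,A,\kappa)(x)=d_S^\pm(S_C^\pm)\pm\tfrac{\kappa}{2}d^2(x,S_H^\pm)\mp\tfrac{\kappa}{2}d^2(x,S_E^\pm).$$ It is known (Wells) that this is well defined on $\mathbb{R}^n$ and continuously differentiable. *)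

theory Defs
  imports "HOL-Analysis.Analysis"
begin

text \<open>
  A 1-field is given by its coefficients: \<open>F x = (f\<^sub>x, D\<^sub>xf)\<close> stands for the polynomial
  \<open>a \<mapsto> f\<^sub>x + \<langle>D\<^sub>xf, a - x\<rangle>\<close>, which determines the pair uniquely.  A 1-field on \<open>\<Omega>\<close> is
  a total function of which only the values on \<open>\<Omega>\<close> are ever used.
\<close>

type_synonym 'a field1 = "'a \<Rightarrow> real \<times> 'a"

definition field_poly :: "'a::euclidean_space field1 \<Rightarrow> 'a \<Rightarrow> 'a \<Rightarrow> real" where
  "field_poly F x a = fst (F x) + snd (F x) \<bullet> (a - x)"

definition Gamma1_at :: "'a::euclidean_space field1 \<Rightarrow> 'a \<Rightarrow> 'a \<Rightarrow> ennreal" where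
  "Gamma1_at F x y =
     2 * (SUP a. ennreal (\<bar>field_poly F x a - field_poly F y a\<bar> / ((norm (x - a))\<^sup>2 + (norm (y - a))\<^sup>2)))"

text \<open>The supremum is taken in \<open>[0, \<infinity>]\<close>; it is \<open>0\<close> when \<open>S\<close> has at most one point.\<close>

definition Gamma1 :: "'a::euclidean_space field1 \<Rightarrow> 'a set \<Rightarrow> ennreal" where
  "Gamma1 F S = (SUP (x, y) \<in> {(x, y). x \<in> S \<and> y \<in> S \<and> x \<noteq> y}. Gamma1_at F x y)"

definition F1 :: "'a::euclidean_space set \<Rightarrow> 'a field1 set" where
  "F1 \<Omega> = {F. \<Omega> \<noteq> {} \<and> Gamma1 F \<Omega> < \<infinity>}"

definition gradient :: "('a::euclidean_space \<Rightarrow> real) \<Rightarrow> 'a \<Rightarrow> 'a" where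
  "gradient w x = (THE D. GDERIV w x :> D)"

definition assoc_field :: "('a::euclidean_space \<Rightarrow> real) \<Rightarrow> 'a field1" where
  "assoc_field w x = (w x, gradient w x)"

definition is_MLE ::
  "'a::euclidean_space set \<Rightarrow> 'a set \<Rightarrow> 'a field1 \<Rightarrow> 'a field1 \<Rightarrow> bool" where
  "is_MLE \<Omega>\<^sub>1 \<Omega>\<^sub>2 F G \<longleftrightarrow>
     \<Omega>\<^sub>1 \<subseteq> \<Omega>\<^sub>2 \<and> F \<in> F1 \<Omega>\<^sub>1 \<and> G \<in> F1 \<Omega>\<^sub>2 \<and>
     (\<forall>x\<in>\<Omega>\<^sub>1. field_poly G x = field_poly F x) \<and> Gamma1 G \<Omega>\<^sub>2 = Gamma1 F \<Omega>\<^sub>1"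

definition is_AMLE ::
  "'a::euclidean_space set \<Rightarrow> 'a set \<Rightarrow> 'a field1 \<Rightarrow> 'a field1 \<Rightarrow> bool" where
  "is_AMLE \<Omega>\<^sub>1 \<Omega>\<^sub>2 F G \<longleftrightarrow>
     is_MLE \<Omega>\<^sub>1 \<Omega>\<^sub>2 F G \<and>
     (\<forall>V. V \<noteq> {} \<and> bounded V \<and> open V \<and> closure V \<subseteq> \<Omega>\<^sub>2 - \<Omega>\<^sub>1 \<longrightarrow>
        Gamma1 G V = Gamma1 G (frontier V))"


text \<open>
  Wells' construction.  The superscripts \<open>+\<close> and \<open>-\<close> become the two values \<open>Upper\<close> and \<open>Lower\<close>;
  \<open>sg\<close> is the sign put in place of \<open>\<plusminus>\<close>.
\<close>

datatype side = Upper | Lower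

fun sg :: "side \<Rightarrow> real" where
  "sg Upper = 1"
| "sg Lower = -1"

definition shifted_pt :: "side \<Rightarrow> 'a::euclidean_space field1 \<Rightarrow> real \<Rightarrow> 'a \<Rightarrow> 'a" where
  "shifted_pt s F \<kappa> p = p - sg s *\<^sub>R (snd (F p) /\<^sub>R \<kappa>)"

definition d_pt :: "side \<Rightarrow> 'a::euclidean_space field1 \<Rightarrow> real \<Rightarrow> 'a \<Rightarrow> 'a \<Rightarrow> real" where
  "d_pt s F \<kappa> p x =
     fst (F p) - sg s * (1 / (2 * \<kappa>)) * (norm (snd (F p)))\<^sup>2
       + sg s * (\<kappa> / 4) * (norm (x - shifted_pt s F \<kappa> p))\<^sup>2"

text \<open>Extended reals, so that \<open>INF\<close> and \<open>SUP\<close> over the empty set are \<open>\<infinity>\<close> and \<open>-\<infinity>\<close>.\<close>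

fun d_set :: "side \<Rightarrow> 'a::euclidean_space field1 \<Rightarrow> real \<Rightarrow> 'a set \<Rightarrow> 'a \<Rightarrow> ereal" where
  "d_set Upper F \<kappa> S x = (INF p\<in>S. ereal (d_pt Upper F \<kappa> p x))"
| "d_set Lower F \<kappa> S x = (SUP p\<in>S. ereal (d_pt Lower F \<kappa> p x))"

definition S_tilde :: "side \<Rightarrow> 'a::euclidean_space field1 \<Rightarrow> real \<Rightarrow> 'a set \<Rightarrow> 'a set" where
  "S_tilde s F \<kappa> S = shifted_pt s F \<kappa> ` S"

definition S_hat :: "side \<Rightarrow> 'a::euclidean_space field1 \<Rightarrow> real \<Rightarrow> 'a set \<Rightarrow> 'a set" where
  "S_hat s F \<kappa> S = convex hull (S_tilde s F \<kappa> S)"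

definition S_H :: "side \<Rightarrow> 'a::euclidean_space field1 \<Rightarrow> real \<Rightarrow> 'a set \<Rightarrow> 'a set" where
  "S_H s F \<kappa> S = affine hull (S_tilde s F \<kappa> S)"

definition S_E :: "side \<Rightarrow> 'a::euclidean_space field1 \<Rightarrow> real \<Rightarrow> 'a set \<Rightarrow> 'a set" where
  "S_E s F \<kappa> S = {x. \<forall>p\<in>S. \<forall>p'\<in>S. d_pt s F \<kappa> p x = d_pt s F \<kappa> p' x}"

fun S_star :: "side \<Rightarrow> 'a::euclidean_space field1 \<Rightarrow> 'a set \<Rightarrow> real \<Rightarrow> 'a set \<Rightarrow> 'a set" where
  "S_star Upper F A \<kappa> S =
     {x. \<forall>p\<in>S. \<forall>p'\<in>S. \<forall>p''\<in>A. d_pt Upper F \<kappa> p x = d_pt Upper F \<kappa> p' x \<and>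
            d_pt Upper F \<kappa> p' x \<le> d_pt Upper F \<kappa> p'' x}"
| "S_star Lower F A \<kappa> S =
     {x. \<forall>p\<in>S. \<forall>p'\<in>S. \<forall>p''\<in>A. d_pt Lower F \<kappa> p x = d_pt Lower F \<kappa> p' x \<and>
            d_pt Lower F \<kappa> p' x \<ge> d_pt Lower F \<kappa> p'' x}"

fun K_set :: "side \<Rightarrow> 'a::euclidean_space field1 \<Rightarrow> 'a set \<Rightarrow> real \<Rightarrow> 'a set set" where
  "K_set Upper F A \<kappa> =
     {S. S \<noteq> {} \<and> S \<subseteq> A \<and>
         (\<exists>x\<in>S_star Upper F A \<kappa> S. d_set Upper F \<kappa> S x < d_set Upper F \<kappa> (A - S) x)}"
| "K_set Lower F A \<kappa> =
     {S. S \<noteq> {} \<and> S \<subseteq> A \<and>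
         (\<exists>x\<in>S_star Lower F A \<kappa> S. d_set Lower F \<kappa> S x > d_set Lower F \<kappa> (A - S) x)}"

text \<open>For \<open>S \<in> K_set s F A \<kappa>\<close> the intersection below is a singleton.\<close>

definition S_C :: "side \<Rightarrow> 'a::euclidean_space field1 \<Rightarrow> real \<Rightarrow> 'a set \<Rightarrow> 'a" where
  "S_C s F \<kappa> S = the_elem (S_E s F \<kappa> S \<inter> S_H s F \<kappa> S)"

definition T_cell ::
  "side \<Rightarrow> 'a::euclidean_space field1 \<Rightarrow> 'a set \<Rightarrow> real \<Rightarrow> 'a set \<Rightarrow> 'a set" where
  "T_cell s F A \<kappa> S = {(1/2) *\<^sub>R (y + z) | y z. y \<in> S_hat s F \<kappa> S \<and> z \<in> S_star s F A \<kappa> S}"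

definition wells_piece ::
  "side \<Rightarrow> 'a::euclidean_space field1 \<Rightarrow> real \<Rightarrow> 'a set \<Rightarrow> 'a \<Rightarrow> real" where
  "wells_piece s F \<kappa> S x =
     real_of_ereal (d_set s F \<kappa> S (S_C s F \<kappa> S))
       + sg s * (\<kappa> / 2) * (infdist x (S_H s F \<kappa> S))\<^sup>2
       - sg s * (\<kappa> / 2) * (infdist x (S_E s F \<kappa> S))\<^sup>2"

text \<open>The description below is definite: the cells cover the space and the pieces agree on overlaps.\<close>

definition wells_fun ::
  "side \<Rightarrow> 'a::euclidean_space field1 \<Rightarrow> 'a set \<Rightarrow> real \<Rightarrow> 'a \<Rightarrow> real" where
  "wells_fun s F A \<kappa> x =
     (THE r. \<exists>S\<in>K_set s F A \<kappa>. x \<in> T_cell s F A \<kappa> S \<and> r = wells_piece s F \<kappa> S x)"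

definition wells_field ::
  "side \<Rightarrow> 'a::euclidean_space field1 \<Rightarrow> 'a set \<Rightarrow> real \<Rightarrow> 'a field1" where
  "wells_field s F A \<kappa> = assoc_field (wells_fun s F A \<kappa>)"

end

theory Submission
  imports Defs
begin

text \<open>
  Fix a sign \<open>s\<close> and let \<open>m\<close> be the minimum over \<open>p \<in> A\<close> of the paraboloids \<open>sg s * d_pt s F \<kappa> p\<close>, so that
  the regions on which a given \<open>p\<close> attains the minimum form a power diagram (weighted Voronoi diagram) of
  the shifted points.  Every point \<open>x\<close> is a midpoint \<open>(y + z) / 2\<close> with \<open>y\<close> in the convex hull of the shifted
  points that are nearest to \<open>z\<close>, and up to the sign Wells' function is
  \<open>w x = m z - \<kappa> / 8 * (norm (y - z))\<^sup>2\<close>.  Up to a quadratic term this is the Moreau envelope of a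
  polyhedral convex function: \<open>y\<close> is the proximal point and \<open>z\<close> is dual to it, which explains the
  existence of the splitting.

  The function \<open>m - \<kappa> / 4 * (norm z)\<^sup>2\<close> is a minimum of affine functions, hence concave, and \<open>y\<close> gives a
  supergradient of it at \<open>z\<close> (\<open>least_power_supergradient\<close>).  Comparing two splittings through this
  inequality yields
  \<open>\<bar>w x' - w x - \<kappa> / 2 * ((z - y) \<bullet> (x' - x))\<bar> \<le> \<kappa> / 2 * (norm (x' - x))\<^sup>2\<close>.
  This one estimate shows that the value does not depend on the splitting, so that Wells' pieces agree on
  overlapping cells; that \<open>w\<close> has gradient \<open>\<kappa> / 2 * (z - y)\<close> at \<open>x\<close>; and, by the triangle inequality
  between the two first order polynomials, that \<open>\<Gamma>\<^sup>1 \<le> \<kappa>\<close> on the whole space.  That the field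
  interpolates \<open>F\<close> amounts to saying that \<open>p\<close> itself is nearest to \<open>z = p + sg s * D\<^sub>p f / \<kappa>\<close>, and this is
  the inequality \<open>\<Gamma>\<^sup>1(F; p, q) \<le> \<kappa>\<close> at one well chosen point (\<open>wells_field_interpolates\<close>).

  Conversely, inside one cell \<open>y\<close> moves in \<open>S_H\<close> and \<open>z\<close> in the orthogonal flat \<open>S_E\<close>, so reflecting one of
  the two components shows that the gradients at \<open>x\<close> and \<open>x'\<close> differ by exactly \<open>\<kappa> * norm (x - x')\<close>, which
  forces \<open>\<Gamma>\<^sup>1 \<ge> \<kappa>\<close> for this pair.  Finitely many cells cover the space, so any infinite set has two points in
  one cell, and \<open>\<Gamma>\<^sup>1\<close> is equal to \<open>\<kappa>\<close> on every infinite set (\<open>Gamma1_wells_field_infinite\<close>).  A nonempty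
  open set is infinite, and in dimension at least two so is the frontier of a nonempty bounded open
  set, since a finite set cannot separate it from the exterior.
\<close>

section \<open>Minima of paraboloids and splittings of points\<close>

locale power_diagram =
  fixes I :: "'i set" and c :: "'i \<Rightarrow> 'a::euclidean_space" and a :: "'i \<Rightarrow> real" and \<kappa> :: real
  assumes finite_sites: "finite I" and sites_nonempty: "I \<noteq> {}" and kappa_pos: "\<kappa> > 0"
begin

definition site_power :: "'i \<Rightarrow> 'a \<Rightarrow> real" where
  "site_power i z = a i + \<kappa> / 4 * (norm (z - c i))\<^sup>2"

definition least_power :: "'a \<Rightarrow> real" where
  "least_power z = Min ((\<lambda>i. site_power i z) ` I)"

definition nearest :: "'a \<Rightarrow> 'i set" where
  "nearest z = {i \<in> I. \<forall>j\<in>I. site_power i z \<le> site_power j z}"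

text \<open>
  For a splitting of \<open>x\<close> the point \<open>z\<close> maximises \<open>least_power z' - \<kappa> / 2 * (norm (x - z'))\<^sup>2\<close> over \<open>z'\<close>, with
  \<open>split_value y z\<close> as maximal value; membership of \<open>y\<close> in the hull is the first order condition.
\<close>
definition splitting :: "'a \<Rightarrow> 'a \<Rightarrow> 'a \<Rightarrow> bool" where
  "splitting x y z \<longleftrightarrow> x = (1/2) *\<^sub>R (y + z) \<and> y \<in> convex hull (c ` nearest z)"

definition split_value :: "'a \<Rightarrow> 'a \<Rightarrow> real" where
  "split_value y z = least_power z - \<kappa> / 8 * (norm (y - z))\<^sup>2"

lemma least_power_le: "i \<in> I \<Longrightarrow> least_power z \<le> site_power i z"
  unfolding least_power_def using finite_sites by simp

lemma least_power_nearest: "i \<in> nearest z \<Longrightarrow> least_power z = site_power i z"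
  unfolding least_power_def nearest_def using finite_sites
  by (intro Min_eqI) auto

lemma nearest_subset: "nearest z \<subseteq> I"
  by (auto simp: nearest_def)

lemma nearest_nonempty: "nearest z \<noteq> {}"
proof -
  have "least_power z \<in> (\<lambda>i. site_power i z) ` I"
    unfolding least_power_def using finite_sites sites_nonempty by simp
  then obtain i where "i \<in> I" "least_power z = site_power i z" by blast
  then have "i \<in> nearest z"
    using least_power_le[of _ z] by (auto simp: nearest_def)
  then show ?thesis by blast
qed

text \<open>
  Subtracting \<open>\<kappa> / 4 * (norm z')\<^sup>2\<close> from the powers makes them affine in \<open>z'\<close> with slopes
  \<open>- (\<kappa> / 2) * c i\<close>.  The slope of a function attaining the minimum at \<open>z\<close> is a supergradient there,
  and supergradients form a convex set.
\<close>
lemma least_power_supergradient: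
  assumes "y \<in> convex hull (c ` nearest z)"
  shows "least_power z' \<le> least_power z + \<kappa> / 4 * ((norm z')\<^sup>2 - (norm z)\<^sup>2) - \<kappa> / 2 * ((z' - z) \<bullet> y)"
proof -
  let ?H = "{y. (\<kappa> / 2) *\<^sub>R (z' - z) \<bullet> y \<le> least_power z - least_power z' + \<kappa> / 4 * ((norm z')\<^sup>2 - (norm z)\<^sup>2)}"
  have "c i \<in> ?H" if i: "i \<in> nearest z" for i
  proof -
    have "least_power z' \<le> site_power i z'" and "least_power z = site_power i z"
      using i nearest_subset least_power_le least_power_nearest by auto
    then show ?thesis
      by (simp add: site_power_def power2_norm_eq_inner inner_diff inner_commute algebra_simps add_divide_distrib diff_divide_distrib)
  qed
  then have "convex hull (c ` nearest z) \<subseteq> ?H"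
    by (intro hull_minimal convex_halfspace_le) blast
  with assms show ?thesis by auto
qed

text \<open>
  The two bounds use the supergradient inequality in opposite directions.  After it is inserted, what
  remains of the difference of the two sides is a single square: \<open>\<kappa> / 4 * (norm (z' - z))\<^sup>2\<close> for the
  lower bound and \<open>\<kappa> / 4 * (norm (y' - y))\<^sup>2\<close> for the upper one.
\<close>
lemma split_value_lower_bound:
  assumes "splitting x y z" and "splitting x' y' z'"
  shows "split_value y z + (\<kappa> / 2) *\<^sub>R (z - y) \<bullet> (x' - x) - \<kappa> / 2 * (norm (x' - x))\<^sup>2 \<le> split_value y' z'"
proof -
  have "least_power z \<le> least_power z' + \<kappa> / 4 * ((norm z)\<^sup>2 - (norm z')\<^sup>2) - \<kappa> / 2 * ((z - z') \<bullet> y')"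
    using assms least_power_supergradient by (auto simp: splitting_def)
  moreover have "0 \<le> \<kappa> / 4 * (norm (z' - z))\<^sup>2"
    using kappa_pos by simp
  ultimately show ?thesis
    using assms unfolding splitting_def split_value_def
    by (simp add: power2_norm_eq_inner inner_diff inner_add inner_commute algebra_simps add_divide_distrib diff_divide_distrib)
qed

lemma split_value_upper_bound:
  assumes "splitting x y z" and "splitting x' y' z'"
  shows "split_value y' z' \<le> split_value y z + (\<kappa> / 2) *\<^sub>R (z - y) \<bullet> (x' - x) + \<kappa> / 2 * (norm (x' - x))\<^sup>2"
proof -
  have "least_power z' \<le> least_power z + \<kappa> / 4 * ((norm z')\<^sup>2 - (norm z)\<^sup>2) - \<kappa> / 2 * ((z' - z) \<bullet> y)"
    using assms least_power_supergradient by (auto simp: splitting_def)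
  moreover have "0 \<le> \<kappa> / 4 * (norm (y' - y))\<^sup>2"
    using kappa_pos by simp
  ultimately show ?thesis
    using assms unfolding splitting_def split_value_def
    by (simp add: power2_norm_eq_inner inner_diff inner_add inner_commute algebra_simps add_divide_distrib diff_divide_distrib)
qed

lemma split_value_unique:
  assumes "splitting x y z" and "splitting x y' z'"
  shows "split_value y z = split_value y' z'"
  using split_value_lower_bound[OF assms] split_value_upper_bound[OF assms] by simp

text \<open>
  The point \<open>y\<close> is found by minimising the convex function
  \<open>\<kappa> / 4 * (norm y)\<^sup>2 - \<kappa> * (x \<bullet> y) + b\<close> over the convex hull of the lifted sites
  \<open>(c i, a i + \<kappa> / 4 * (norm (c i))\<^sup>2)\<close>.  By the first order condition its linearisation at a minimiser
  \<open>v = (y, b)\<close> supports the hull, so \<open>v\<close> lies on a face spanned by lifted sites; the linearisation is, up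
  to a constant, the power with respect to \<open>z = 2 *\<^sub>R x - y\<close>, so those sites are nearest to \<open>z\<close>.
\<close>
lemma splitting_exists: "\<exists>y z. splitting x y z"
proof -
  define site where "site i = (c i, a i + \<kappa> / 4 * (norm (c i))\<^sup>2)" for i
  define H where "H = convex hull (site ` I)"
  define J where "J v = \<kappa> / 4 * (norm (fst v))\<^sup>2 - \<kappa> * (x \<bullet> fst v) + snd v" for v :: "'a \<times> real"
  have "compact H" "H \<noteq> {}"
    unfolding H_def using finite_sites sites_nonempty by (auto intro!: finite_imp_compact_convex_hull)
  moreover have "continuous_on H J"
    unfolding J_def by (intro continuous_intros)
  ultimately obtain v where v: "v \<in> H" and J_min: "\<And>u. u \<in> H \<Longrightarrow> J v \<le> J u"
    using continuous_attains_inf[of H J] by blast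
  define y where "y = fst v"
  define z where "z = 2 *\<^sub>R x - y"
  define normal where "normal = (- (\<kappa> / 2) *\<^sub>R z, 1 :: real)"
  have supporting: "normal \<bullet> v \<le> normal \<bullet> u" if u: "u \<in> H" for u
  proof (rule ccontr)
    define L where "L = normal \<bullet> u - normal \<bullet> v"
    define Q where "Q = \<kappa> / 4 * (norm (fst u - y))\<^sup>2"
    \<comment> \<open>Towards \<open>u\<close> the function \<open>J\<close> changes by \<open>t * L + t\<^sup>2 * Q\<close>; this step size makes the change negative.\<close>
    define t where "t = - L / (Q - L)"
    assume "\<not> normal \<bullet> v \<le> normal \<bullet> u"
    then have L: "L < 0" by (simp add: L_def)
    have Q: "Q \<ge> 0" using kappa_pos by (simp add: Q_def)
    have t: "0 < t" "t \<le> 1" using L Q by (auto simp: t_def divide_simps)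
    have "(1 - t) *\<^sub>R v + t *\<^sub>R u \<in> H"
      using v u t unfolding H_def by (intro convexD) auto
    then have "0 \<le> J ((1 - t) *\<^sub>R v + t *\<^sub>R u) - J v"
      using J_min by simp
    also have "\<dots> = t * (L + t * Q)"
    proof -
      define d where "d = fst u - y"
      have "(1 - t) *\<^sub>R v + t *\<^sub>R u = (y + t *\<^sub>R d, snd v + t * (snd u - snd v))"
        by (cases u; cases v) (simp add: y_def d_def algebra_simps)
      then have J_eq: "J ((1 - t) *\<^sub>R v + t *\<^sub>R u) - J v =
          \<kappa> / 4 * (2 * t * (y \<bullet> d) + t * t * (d \<bullet> d)) - \<kappa> * t * (x \<bullet> d) + t * (snd u - snd v)"
        unfolding J_def y_def[symmetric]
        by (simp add: power2_norm_eq_inner inner_add inner_commute algebra_simps add_divide_distrib)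
      have L_eq: "L = \<kappa> / 2 * (y \<bullet> d) - \<kappa> * (x \<bullet> d) + (snd u - snd v)"
        unfolding L_def normal_def z_def d_def y_def
        by (cases u; cases v) (simp add: inner_diff inner_commute algebra_simps diff_divide_distrib)
      have Q_eq: "Q = \<kappa> / 4 * (d \<bullet> d)"
        by (simp add: Q_def d_def power2_norm_eq_inner)
      show ?thesis unfolding J_eq L_eq Q_eq by (simp add: algebra_simps)
    qed
    also have "L + t * Q = - (L\<^sup>2 / (Q - L))"
      using L Q by (simp add: t_def field_simps power2_eq_square)
    finally have "0 \<le> - (t * (L\<^sup>2 / (Q - L)))"
      by simp
    moreover have "t * (L\<^sup>2 / (Q - L)) > 0"
      using t L Q by (intro mult_pos_pos divide_pos_pos) auto
    ultimately show False by simp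
  qed
  then have "H \<inter> {u. normal \<bullet> u = normal \<bullet> v} face_of convex hull (site ` I)"
    unfolding H_def by (intro face_of_Int_supporting_hyperplane_ge) auto
  then obtain P where P: "P \<subseteq> site ` I" "H \<inter> {u. normal \<bullet> u = normal \<bullet> v} = convex hull P"
    using finite_sites by (elim face_of_convex_hull_subset[rotated]) (auto simp: finite_imp_compact)
  have "fst ` P \<subseteq> c ` nearest z"
  proof clarify
    fix u\<^sub>1 u\<^sub>2 assume u: "(u\<^sub>1, u\<^sub>2) \<in> P"
    then obtain i where i: "i \<in> I" "(u\<^sub>1, u\<^sub>2) = site i"
      using P by auto
    have on_face: "normal \<bullet> site i = normal \<bullet> v"
      using P(2) u i hull_inc[OF u] by auto
    have "normal \<bullet> site i \<le> normal \<bullet> site j" if "j \<in> I" for j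
      using that on_face supporting hull_inc[of "site j" "site ` I"] by (simp add: H_def)
    then have "site_power i z \<le> site_power j z" if "j \<in> I" for j
      using that
      by (simp add: site_power_def normal_def site_def power2_norm_eq_inner inner_diff inner_commute algebra_simps add_divide_distrib diff_divide_distrib)
    then show "fst (u\<^sub>1, u\<^sub>2) \<in> c ` nearest z"
      using i by (auto simp: nearest_def site_def)
  qed
  moreover have "y \<in> fst ` (convex hull P)"
    using v P(2) by (auto simp: y_def)
  then have "y \<in> convex hull (fst ` P)"
    by (simp add: convex_hull_linear_image linear_fst)
  ultimately have "y \<in> convex hull (c ` nearest z)"
    using hull_mono by blast
  then have "splitting x y z"
    by (simp add: splitting_def z_def)
  then show ?thesis by blast
qed

end

section \<open>The functional \<open>\<Gamma>\<^sup>1\<close> and gradients\<close>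

lemma Gamma1_at_le_of_quadratic_bound:
  fixes F :: "'a::euclidean_space field1"
  assumes "\<kappa> \<ge> 0"
    and bound: "\<And>b. \<bar>field_poly F x b - field_poly F y b\<bar> \<le> \<kappa> / 2 * ((norm (x - b))\<^sup>2 + (norm (y - b))\<^sup>2)"
  shows "Gamma1_at F x y \<le> ennreal \<kappa>"
proof -
  have "(SUP b. ennreal (\<bar>field_poly F x b - field_poly F y b\<bar> / ((norm (x - b))\<^sup>2 + (norm (y - b))\<^sup>2))) \<le> ennreal (\<kappa> / 2)"
  proof (intro SUP_least ennreal_leI)
    fix b
    let ?d = "(norm (x - b))\<^sup>2 + (norm (y - b))\<^sup>2"
    show "\<bar>field_poly F x b - field_poly F y b\<bar> / ?d \<le> \<kappa> / 2"
    proof (cases "?d = 0")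
      case True
      then show ?thesis using assms(1) by (simp only: div_by_0)
    next
      case False
      then have "?d > 0" using zero_le_power2[of "norm (x - b)"] zero_le_power2[of "norm (y - b)"] by linarith
      then show ?thesis using bound[of b] by (subst pos_divide_le_eq)
    qed
  qed
  then have "Gamma1_at F x y \<le> 2 * ennreal (\<kappa> / 2)"
    unfolding Gamma1_at_def by (intro mult_left_mono) auto
  also have "\<dots> = ennreal \<kappa>"
    using assms(1) by (simp add: ennreal_mult[symmetric] flip: ennreal_numeral)
  finally show ?thesis .
qed

lemma quotient_le_Gamma1_at:
  "ennreal (2 * (\<bar>field_poly F x b - field_poly F y b\<bar> / ((norm (x - b))\<^sup>2 + (norm (y - b))\<^sup>2))) \<le> Gamma1_at F x y"
proof -
  have "ennreal (\<bar>field_poly F x b - field_poly F y b\<bar> / ((norm (x - b))\<^sup>2 + (norm (y - b))\<^sup>2)) \<le>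
    (SUP b. ennreal (\<bar>field_poly F x b - field_poly F y b\<bar> / ((norm (x - b))\<^sup>2 + (norm (y - b))\<^sup>2)))"
    by (rule SUP_upper) simp
  then have "2 * ennreal (\<bar>field_poly F x b - field_poly F y b\<bar> / ((norm (x - b))\<^sup>2 + (norm (y - b))\<^sup>2)) \<le> Gamma1_at F x y"
    unfolding Gamma1_at_def by (rule mult_left_mono) simp
  then show ?thesis
    by (simp only: ennreal_mult' ennreal_numeral zero_le_numeral)
qed

lemma quadratic_bound_of_Gamma1_at:
  assumes "Gamma1_at F x y \<le> ennreal \<kappa>" and "\<kappa> \<ge> 0" and "x \<noteq> y"
  shows "\<bar>field_poly F x b - field_poly F y b\<bar> \<le> \<kappa> / 2 * ((norm (x - b))\<^sup>2 + (norm (y - b))\<^sup>2)"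
proof -
  have pos: "(norm (x - b))\<^sup>2 + (norm (y - b))\<^sup>2 > 0"
    using assms(3) by (auto simp: sum_power2_gt_zero_iff)
  have "2 * (\<bar>field_poly F x b - field_poly F y b\<bar> / ((norm (x - b))\<^sup>2 + (norm (y - b))\<^sup>2)) \<le> \<kappa>"
    using order_trans[OF quotient_le_Gamma1_at assms(1)] assms(2) by (simp add: ennreal_le_iff)
  with pos show ?thesis by (simp add: field_simps)
qed

text \<open>
  The difference of the two polynomials is affine with slope \<open>D = D\<^sub>x f - D\<^sub>y f\<close>.  Leaving the midpoint \<open>m\<close> of
  \<open>x\<close> and \<open>y\<close> in the direction \<open>\<plusminus> D\<close>, with the sign of the value at \<open>m\<close>, its absolute value reaches at
  least \<open>norm D\<close> times the distance travelled; travelling half the distance of \<open>x\<close> and \<open>y\<close> is optimal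
  against the denominator.
\<close>
lemma gradient_quotient_le_Gamma1_at:
  fixes F :: "'a::euclidean_space field1"
  assumes "x \<noteq> y"
  shows "ennreal (norm (snd (F x) - snd (F y)) / norm (x - y)) \<le> Gamma1_at F x y"
proof (cases "snd (F x) = snd (F y)")
  case True
  then show ?thesis by simp
next
  case False
  define D where "D = snd (F x) - snd (F y)"
  define h where "h = norm (x - y) / 2"
  define e where "e = (h / norm D) *\<^sub>R D"
  define m where "m = (1/2) *\<^sub>R (x + y)"
  define v where "v = field_poly F x m - field_poly F y m"
  define \<sigma> where "\<sigma> = (if v \<ge> 0 then 1 else - 1 :: real)"
  have h: "h > 0" and D: "norm D > 0" using assms False by (auto simp: h_def D_def)
  have eD: "D \<bullet> e = h * norm D" and norm_e: "norm e = h"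
    using D h by (auto simp: e_def power2_norm_eq_inner[symmetric] power2_eq_square)
  have \<sigma>: "\<sigma> * \<sigma> = 1" by (simp add: \<sigma>_def)
  define b where "b = m + \<sigma> *\<^sub>R e"
  have "field_poly F x b - field_poly F y b = v + \<sigma> * (h * norm D)"
    unfolding eD[symmetric] unfolding field_poly_def v_def b_def D_def
    by (simp add: algebra_simps)
  then have num: "\<bar>field_poly F x b - field_poly F y b\<bar> \<ge> h * norm D"
    using h D by (auto simp: \<sigma>_def)
  have "(norm (x - b))\<^sup>2 + (norm (y - b))\<^sup>2 = 2 * (\<sigma> * \<sigma>) * (norm e)\<^sup>2 + (norm (x - y))\<^sup>2 / 2"
    unfolding b_def m_def
    by (simp add: power2_norm_eq_inner inner_add inner_diff inner_commute algebra_simps add_divide_distrib diff_divide_distrib)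
  also have "\<dots> = 4 * h\<^sup>2"
    unfolding \<sigma> norm_e by (simp add: h_def power_divide)
  finally have den: "(norm (x - b))\<^sup>2 + (norm (y - b))\<^sup>2 = 4 * h\<^sup>2" .
  have "norm D / norm (x - y) = 2 * (h * norm D / (4 * h\<^sup>2))"
    using h by (simp add: h_def power2_eq_square)
  also have "\<dots> \<le> 2 * (\<bar>field_poly F x b - field_poly F y b\<bar> / (4 * h\<^sup>2))"
    using num h by (intro mult_left_mono divide_right_mono) auto
  finally have "ennreal (norm D / norm (x - y)) \<le>
      ennreal (2 * (\<bar>field_poly F x b - field_poly F y b\<bar> / ((norm (x - b))\<^sup>2 + (norm (y - b))\<^sup>2)))"
    unfolding den by (rule ennreal_leI)
  also have "\<dots> \<le> Gamma1_at F x y"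
    by (rule quotient_le_Gamma1_at)
  finally show ?thesis by (simp add: D_def)
qed

lemma Gamma1_at_le_Gamma1: "x \<in> S \<Longrightarrow> y \<in> S \<Longrightarrow> x \<noteq> y \<Longrightarrow> Gamma1_at F x y \<le> Gamma1 F S"
  unfolding Gamma1_def by (rule SUP_upper2[of "(x, y)"]) auto

lemma Gamma1_le:
  assumes "\<And>x y. x \<in> S \<Longrightarrow> y \<in> S \<Longrightarrow> x \<noteq> y \<Longrightarrow> Gamma1_at F x y \<le> M"
  shows "Gamma1 F S \<le> M"
  unfolding Gamma1_def using assms by (intro SUP_least) auto

lemma GDERIV_of_quadratic_bound:
  fixes w :: "'a::euclidean_space \<Rightarrow> real"
  assumes "\<And>x'. \<bar>w x' - w x - D \<bullet> (x' - x)\<bar> \<le> C * (norm (x' - x))\<^sup>2"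
  shows "GDERIV w x :> D"
  unfolding gderiv_def
proof (rule has_derivativeI_sandwich[where e = 1 and H = "\<lambda>x'. C * norm (x' - x)"])
  show "bounded_linear (\<lambda>h. h \<bullet> D)" by (rule bounded_linear_inner_left)
  have "((\<lambda>x'. C * norm (x' - x)) \<longlongrightarrow> C * norm (x - x)) (at x)"
    by (intro tendsto_intros)
  then show "((\<lambda>x'. C * norm (x' - x)) \<longlongrightarrow> 0) (at x)" by simp
  fix x' assume "x' \<noteq> x"
  with assms[of x'] show "norm (w x' - w x - (x' - x) \<bullet> D) / norm (x' - x) \<le> C * norm (x' - x)"
    by (simp add: pos_divide_le_eq power2_eq_square inner_commute mult.assoc)
qed simp

lemma gradient_eq:
  assumes "GDERIV w x :> D"
  shows "gradient w x = D"
  unfolding gradient_def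
proof (rule the_equality)
  show "GDERIV w x :> D" by (fact assms)
  fix D' assume "GDERIV w x :> D'"
  then have "(\<lambda>h. h \<bullet> D') = (\<lambda>h. h \<bullet> D)"
    using assms unfolding gderiv_def by (rule has_derivative_unique)
  then have "h \<bullet> D' = h \<bullet> D" for h by (rule fun_cong)
  then have "(D' - D) \<bullet> (D' - D) = 0" by (simp only: inner_diff_right)
  then show "D' = D" by simp
qed

text \<open>
  A finite frontier would have connected complement in dimension at least two, while that
  complement meets both \<open>V\<close> and the exterior of \<open>V\<close>.
\<close>
lemma infinite_frontier:
  fixes V :: "'a::euclidean_space set"
  assumes "DIM('a) \<ge> 2" and "bounded V" and "open V" and "V \<noteq> {}"
  shows "infinite (frontier V)"
proof
  assume fin: "finite (frontier V)"
  then have "connected (- frontier V)"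
    using assms(1) by (intro path_connected_imp_connected path_connected_complement_countable)
      (auto intro: countable_finite)
  moreover have "- frontier V \<inter> V \<noteq> {}"
    using assms by (auto simp: frontier_def interior_open)
  moreover have "bounded (frontier V \<union> V)"
    using fin assms(2) by (simp add: finite_imp_bounded)
  then have "frontier V \<union> V \<noteq> UNIV"
    using not_bounded_UNIV by metis
  then have "- frontier V - V \<noteq> {}" by blast
  ultimately show False
    using connected_Int_frontier by blast
qed

lemma infdist_orthogonal_foot:
  fixes x :: "'a::euclidean_space"
  assumes "q \<in> M" and "\<And>m. m \<in> M \<Longrightarrow> (x - q) \<bullet> (m - q) = 0"
  shows "infdist x M = norm (x - q)"
proof (rule antisym)
  show "infdist x M \<le> norm (x - q)"
    using infdist_le[OF assms(1), of x] by (simp add: dist_norm)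
  have "norm (x - q) \<le> dist x m" if "m \<in> M" for m
  proof -
    have "(norm (x - m))\<^sup>2 = (norm (x - q))\<^sup>2 + (norm (m - q))\<^sup>2"
      using assms(2)[OF that] by (simp add: power2_norm_eq_inner inner_diff inner_commute)
    then have "(norm (x - q))\<^sup>2 \<le> (norm (x - m))\<^sup>2" by simp
    then show ?thesis unfolding dist_norm by (rule power2_le_imp_le) simp
  qed
  moreover have M: "M \<noteq> {}" using assms(1) by blast
  ultimately show "norm (x - q) \<le> infdist x M"
    unfolding infdist_notempty[OF M] by (intro cINF_greatest[OF M])
qed

section \<open>Wells' cells in terms of nearest sites\<close>

lemma sg_square [simp]: "sg s * sg s = 1"
  by (cases s) auto

lemma sg_cancel [simp]: "sg s * (sg s * r) = r"
  by (cases s) auto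

lemma sg_nonzero [simp]: "sg s \<noteq> 0"
  by (cases s) auto

text \<open>
  Multiplying by \<open>sg s\<close> turns maxima of the lower paraboloids into minima, so that from here on the two
  signs are treated together.
\<close>
lemma S_star_signed:
  "S_star s F A \<kappa> S =
    {x. \<forall>p\<in>S. \<forall>p'\<in>S. \<forall>p''\<in>A. sg s * d_pt s F \<kappa> p x = sg s * d_pt s F \<kappa> p' x \<and>
      sg s * d_pt s F \<kappa> p' x \<le> sg s * d_pt s F \<kappa> p'' x}"
  by (cases s) simp_all

lemma K_setI:
  assumes "finite A" and "p \<in> S" and "S \<subseteq> A" and "x \<in> S_star s F A \<kappa> S"
    and less: "\<And>q. q \<in> A - S \<Longrightarrow> sg s * d_pt s F \<kappa> p x < sg s * d_pt s F \<kappa> q x"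
  shows "S \<in> K_set s F A \<kappa>"
proof -
  have fin: "finite (A - S)" using assms(1) by simp
  show ?thesis
  proof (cases s)
    case Upper
    have "d_set Upper F \<kappa> S x \<le> ereal (d_pt Upper F \<kappa> p x)"
      using assms(2) by (auto intro: INF_lower)
    also have "\<dots> < d_set Upper F \<kappa> (A - S) x"
    proof (cases "A - S = {}")
      case True
      then show ?thesis by (simp only: d_set.simps image_empty Inf_empty) (simp add: top_ereal_def)
    next
      case False
      then show ?thesis
        using fin less Upper by (simp add: finite_less_Inf_iff)
    qed
    finally show ?thesis
      using assms(2-4) Upper by auto
  next
    case Lower
    have "d_set Lower F \<kappa> (A - S) x < ereal (d_pt Lower F \<kappa> p x)"
    proof (cases "A - S = {}")
      case True
      then show ?thesis by (simp only: d_set.simps image_empty Sup_empty) (simp add: bot_ereal_def)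
    next
      case False
      then show ?thesis
        using fin less Lower by (simp add: finite_Sup_less_iff)
    qed
    also have "\<dots> \<le> d_set Lower F \<kappa> S x"
      using assms(2) by (auto intro: SUP_upper)
    finally show ?thesis
      using assms(2-4) Lower by auto
  qed
qed

lemma K_set_subset: "S \<in> K_set s F A \<kappa> \<Longrightarrow> S \<noteq> {} \<and> S \<subseteq> A"
  by (cases s) auto

lemma S_star_subset_S_E: "S \<subseteq> A \<Longrightarrow> S_star s F A \<kappa> S \<subseteq> S_E s F \<kappa> S"
  by (cases s; simp only: S_star.simps S_E_def; blast)

lemma d_set_S_E:
  assumes "x \<in> S_E s F \<kappa> S" and "p \<in> S"
  shows "real_of_ereal (d_set s F \<kappa> S x) = d_pt s F \<kappa> p x"
proof -
  have "d_pt s F \<kappa> q x = d_pt s F \<kappa> p x" if "q \<in> S" for q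
    using assms that unfolding S_E_def by blast
  then have "(\<lambda>q. ereal (d_pt s F \<kappa> q x)) ` S = (\<lambda>q. ereal (d_pt s F \<kappa> p x)) ` S"
    by (intro image_cong) simp_all
  also have "\<dots> = {ereal (d_pt s F \<kappa> p x)}"
    using assms(2) by (rule image_constant)
  finally have "(\<lambda>q. ereal (d_pt s F \<kappa> q x)) ` S = {ereal (d_pt s F \<kappa> p x)}" .
  then show ?thesis
    by (cases s) simp_all
qed

locale wells_construction =
  fixes s :: side and F :: "'a::euclidean_space field1" and A :: "'a set" and \<kappa> :: real
  assumes finite_A: "finite A" and A_nonempty: "A \<noteq> {}" and kappa_pos: "\<kappa> > 0"
begin

definition vertex_value :: "'a \<Rightarrow> real" where
  "vertex_value p = sg s * fst (F p) - (norm (snd (F p)))\<^sup>2 / (2 * \<kappa>)"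

sublocale power_diagram A "shifted_pt s F \<kappa>" vertex_value \<kappa>
  by unfold_locales (fact finite_A A_nonempty kappa_pos)+

lemma d_pt_eq_site_power: "d_pt s F \<kappa> p x = sg s * site_power p x"
  unfolding d_pt_def site_power_def vertex_value_def by (simp add: right_diff_distrib distrib_left)

lemma S_star_iff_subset_nearest:
  assumes "S \<noteq> {}" and "S \<subseteq> A"
  shows "z \<in> S_star s F A \<kappa> S \<longleftrightarrow> S \<subseteq> nearest z"
proof -
  have "z \<in> S_star s F A \<kappa> S \<longleftrightarrow>
      (\<forall>p\<in>S. \<forall>p'\<in>S. \<forall>p''\<in>A. site_power p z = site_power p' z \<and> site_power p' z \<le> site_power p'' z)"
    by (simp add: S_star_signed d_pt_eq_site_power)
  also have "\<dots> \<longleftrightarrow> S \<subseteq> nearest z"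
  proof
    assume "S \<subseteq> nearest z"
    then have "site_power p z \<le> site_power q z" if "p \<in> S" "q \<in> A" for p q
      using that by (auto simp: nearest_def)
    then show "\<forall>p\<in>S. \<forall>p'\<in>S. \<forall>p''\<in>A. site_power p z = site_power p' z \<and> site_power p' z \<le> site_power p'' z"
      using assms(2) by (meson antisym subsetD)
  qed (use assms in \<open>auto simp: nearest_def\<close>)
  finally show ?thesis .
qed

text \<open>
  The cells of the sets \<open>nearest z\<close> will cover the space; for such a set \<open>z\<close> itself witnesses the strict
  inequality in the definition of \<open>K_set\<close>.
\<close>
lemma nearest_in_K_set: "nearest z \<in> K_set s F A \<kappa>"
proof -
  obtain p where p: "p \<in> nearest z" using nearest_nonempty by blast
  have "z \<in> S_star s F A \<kappa> (nearest z)"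
    using S_star_iff_subset_nearest[OF nearest_nonempty nearest_subset] by blast
  moreover have "site_power p z < site_power q z" if "q \<in> A - nearest z" for q
    using p that unfolding nearest_def by fastforce
  ultimately show ?thesis
    using finite_A p nearest_subset by (intro K_setI) (auto simp: d_pt_eq_site_power)
qed

lemma cells_cover: "\<exists>S\<in>K_set s F A \<kappa>. x \<in> T_cell s F A \<kappa> S"
proof -
  obtain y z where "splitting x y z" using splitting_exists by blast
  then have "x \<in> T_cell s F A \<kappa> (nearest z)"
    using S_star_iff_subset_nearest[OF nearest_nonempty nearest_subset, of z z]
    unfolding splitting_def T_cell_def S_hat_def S_tilde_def by blast
  with nearest_in_K_set show ?thesis by blast
qed

lemma T_cell_splitting:
  assumes "S \<in> K_set s F A \<kappa>" and "x \<in> T_cell s F A \<kappa> S"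
  obtains y z where "y \<in> S_hat s F \<kappa> S" "z \<in> S_star s F A \<kappa> S" "x = (1/2) *\<^sub>R (y + z)" "splitting x y z"
proof -
  obtain y z where yz: "y \<in> S_hat s F \<kappa> S" "z \<in> S_star s F A \<kappa> S" "x = (1/2) *\<^sub>R (y + z)"
    using assms(2) unfolding T_cell_def by blast
  have "S \<subseteq> nearest z"
    using yz(2) K_set_subset[OF assms(1)] S_star_iff_subset_nearest by blast
  then have "S_hat s F \<kappa> S \<subseteq> convex hull (shifted_pt s F \<kappa> ` nearest z)"
    unfolding S_hat_def S_tilde_def by (intro hull_mono image_mono)
  with yz that show thesis by (auto simp: splitting_def)
qed

lemma S_E_iff: "x \<in> S_E s F \<kappa> S \<longleftrightarrow> (\<forall>p\<in>S. \<forall>p'\<in>S. site_power p x = site_power p' x)"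
  by (simp add: S_E_def d_pt_eq_site_power)

text \<open>
  All paraboloids \<open>d_pt\<close> have the same quadratic part, so equality of two of them is a linear equation whose
  normal vector is the difference of their centres; \<open>S_E\<close> is the solution set of these equations.
\<close>
lemma S_H_orthogonal_S_E:
  assumes "e \<in> S_E s F \<kappa> S" "e' \<in> S_E s F \<kappa> S" "m \<in> S_H s F \<kappa> S" "m' \<in> S_H s F \<kappa> S"
  shows "(e - e') \<bullet> (m - m') = 0"
proof (cases "S = {}")
  case True
  then show ?thesis using assms by (simp add: S_H_def S_tilde_def)
next
  case False
  then obtain p where p: "p \<in> S" by blast
  let ?c = "shifted_pt s F \<kappa>"
  let ?P = "{m. (e - e') \<bullet> m = (e - e') \<bullet> ?c p}"
  have "?c q \<in> ?P" if q: "q \<in> S" for q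
  proof -
    have "site_power p e = site_power q e" "site_power p e' = site_power q e'"
      using p q assms(1,2) unfolding S_E_iff by blast+
    then have "\<kappa> * ((e - e') \<bullet> ?c q) = \<kappa> * ((e - e') \<bullet> ?c p)"
      unfolding site_power_def
      by (simp add: power2_norm_eq_inner inner_diff inner_commute algebra_simps diff_divide_distrib add_divide_distrib)
    then show ?thesis using kappa_pos by simp
  qed
  then have "S_H s F \<kappa> S \<subseteq> ?P"
    unfolding S_H_def S_tilde_def by (intro hull_minimal affine_hyperplane) auto
  then have "m \<in> ?P" "m' \<in> ?P" using assms(3,4) by blast+
  then show ?thesis by (simp add: inner_diff_right)
qed

text \<open>
  The common point is the foot \<open>q\<close> of the perpendicular from any \<open>e \<in> S_E\<close> to \<open>S_H\<close>: by Pythagoras,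
  passing from \<open>e\<close> to \<open>q\<close> lowers all powers with respect to points of \<open>S\<close> by the same amount.
  Orthogonality makes it unique, so \<open>S_C\<close> denotes it.
\<close>
lemma S_C_in:
  assumes "S \<noteq> {}" and "e \<in> S_E s F \<kappa> S"
  shows "S_C s F \<kappa> S \<in> S_E s F \<kappa> S \<inter> S_H s F \<kappa> S"
proof -
  let ?H = "S_H s F \<kappa> S" and ?E = "S_E s F \<kappa> S" and ?c = "shifted_pt s F \<kappa>"
  have H: "affine ?H" "closed ?H" "?H \<noteq> {}"
    using assms(1) by (auto simp: S_H_def S_tilde_def)
  define q where "q = closest_point ?H e"
  have qH: "q \<in> ?H" using H by (simp add: q_def closest_point_in_set)
  have perp: "(e - q) \<bullet> (m - q) = 0" if m: "m \<in> ?H" for m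
  proof (rule antisym)
    show "(e - q) \<bullet> (m - q) \<le> 0"
      unfolding q_def using H m by (intro closest_point_dot affine_imp_convex)
    \<comment> \<open>The obtuse angle criterion at the reflection of \<open>m\<close> in \<open>q\<close> gives the opposite inequality.\<close>
    have "2 *\<^sub>R q - m \<in> ?H"
      using mem_affine[OF H(1) qH m, of 2 "-1"] by simp
    then have "(e - q) \<bullet> ((2 *\<^sub>R q - m) - q) \<le> 0"
      unfolding q_def using H by (intro closest_point_dot affine_imp_convex)
    then show "0 \<le> (e - q) \<bullet> (m - q)"
      by (simp add: inner_diff_right inner_add_right scaleR_2)
  qed
  have "site_power p q = site_power p e - \<kappa> / 4 * (norm (e - q))\<^sup>2" if "p \<in> S" for p
  proof -
    have "?c p \<in> ?H" unfolding S_H_def S_tilde_def using that by (simp add: hull_inc)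
    then have "(e - q) \<bullet> (?c p - q) = 0" by (rule perp)
    then have "(norm (e - ?c p))\<^sup>2 = (norm (e - q))\<^sup>2 + (norm (q - ?c p))\<^sup>2"
      by (simp add: power2_norm_eq_inner inner_diff inner_commute)
    then show ?thesis by (simp add: site_power_def algebra_simps)
  qed
  moreover have "site_power p e = site_power p' e" if "p \<in> S" "p' \<in> S" for p p'
    using assms(2) that unfolding S_E_iff by blast
  ultimately have qE: "q \<in> ?E"
    unfolding S_E_iff by metis
  have "?E \<inter> ?H = {q}"
  proof -
    have "m = q" if "m \<in> ?E" "m \<in> ?H" for m
      using S_H_orthogonal_S_E[OF that(1) qE that(2) qH] by simp
    with qE qH show ?thesis by blast
  qed
  then show ?thesis by (simp add: S_C_def)
qed

text \<open>
  Relative to the centre \<open>q = S_C\<close>, write \<open>y = q + u\<close> and \<open>z = q + v\<close> with \<open>u\<close> along \<open>S_H\<close>, \<open>v\<close> along \<open>S_E\<close> and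
  \<open>u \<bullet> v = 0\<close>.  Then \<open>x = q + u/2 + v/2\<close> has distance \<open>norm v / 2\<close> to \<open>S_H\<close> and \<open>norm u / 2\<close> to \<open>S_E\<close>, and
  Pythagoras identifies the two expressions.
\<close>
lemma wells_piece_eq_split_value:
  assumes S: "S \<in> K_set s F A \<kappa>" and y: "y \<in> S_hat s F \<kappa> S" and z: "z \<in> S_star s F A \<kappa> S"
  shows "wells_piece s F \<kappa> S ((1/2) *\<^sub>R (y + z)) = sg s * split_value y z"
proof -
  define x where "x = (1/2) *\<^sub>R (y + z)"
  define q where "q = S_C s F \<kappa> S"
  have S_ne: "S \<noteq> {}" and SA: "S \<subseteq> A" using K_set_subset[OF S] by auto
  obtain p where p: "p \<in> S" using S_ne by blast
  have zE: "z \<in> S_E s F \<kappa> S" using z S_star_subset_S_E[OF SA] by blast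
  have yH: "y \<in> S_H s F \<kappa> S"
    using y convex_hull_subset_affine_hull unfolding S_hat_def S_H_def by blast
  have qE: "q \<in> S_E s F \<kappa> S" and qH: "q \<in> S_H s F \<kappa> S"
    using S_C_in[OF S_ne zE] by (auto simp: q_def)
  define u where "u = y - q"
  define v where "v = z - q"
  have x_uv: "x = q + (1/2) *\<^sub>R u + (1/2) *\<^sub>R v"
    unfolding x_def u_def v_def by (simp add: algebra_simps flip: scaleR_add_left)
  have uv: "u \<bullet> v = 0"
    using S_H_orthogonal_S_E[OF zE qE yH qH] by (simp add: u_def v_def inner_commute)
  \<comment> \<open>Moving along \<open>v\<close>, orthogonally to \<open>S_H\<close>, raises all powers with respect to points of \<open>S\<close> equally.\<close>
  have along_v: "site_power r (q + t *\<^sub>R v) = site_power r q + \<kappa> / 4 * (t\<^sup>2 * (norm v)\<^sup>2)" if "r \<in> S" for r t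
  proof -
    have "shifted_pt s F \<kappa> r \<in> S_H s F \<kappa> S"
      unfolding S_H_def S_tilde_def using that by (simp add: hull_inc)
    then have "v \<bullet> (q - shifted_pt s F \<kappa> r) = 0"
      using S_H_orthogonal_S_E[OF zE qE qH] by (simp add: v_def)
    then have "(norm ((q - shifted_pt s F \<kappa> r) + t *\<^sub>R v))\<^sup>2 = (norm (q - shifted_pt s F \<kappa> r))\<^sup>2 + t\<^sup>2 * (norm v)\<^sup>2"
      by (simp add: norm_add_Pythagorean orthogonal_def inner_commute power_mult_distrib)
    then show ?thesis by (simp add: site_power_def algebra_simps)
  qed
  have x_H: "x - (q + (1/2) *\<^sub>R u) = (1/2) *\<^sub>R v" and x_E: "x - (q + (1/2) *\<^sub>R v) = (1/2) *\<^sub>R u"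
    by (simp_all add: x_uv)
  have infdist_H: "infdist x (S_H s F \<kappa> S) = norm (x - (q + (1/2) *\<^sub>R u))"
  proof (rule infdist_orthogonal_foot)
    have foot: "q + (1/2) *\<^sub>R u = (1/2) *\<^sub>R q + (1/2) *\<^sub>R y"
      by (simp add: u_def algebra_simps flip: scaleR_add_left)
    show footH: "q + (1/2) *\<^sub>R u \<in> S_H s F \<kappa> S"
      unfolding foot by (rule mem_affine[OF _ qH yH]) (simp_all add: S_H_def)
    fix m assume "m \<in> S_H s F \<kappa> S"
    then show "(x - (q + (1/2) *\<^sub>R u)) \<bullet> (m - (q + (1/2) *\<^sub>R u)) = 0"
      using S_H_orthogonal_S_E[OF zE qE _ footH, of m] unfolding x_H by (simp add: v_def)
  qed
  have dist_H: "(infdist x (S_H s F \<kappa> S))\<^sup>2 = (norm v)\<^sup>2 / 4"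
    unfolding infdist_H x_H by (simp add: power_divide)
  have infdist_E: "infdist x (S_E s F \<kappa> S) = norm (x - (q + (1/2) *\<^sub>R v))"
  proof (rule infdist_orthogonal_foot)
    show footE: "q + (1/2) *\<^sub>R v \<in> S_E s F \<kappa> S"
      using qE along_v unfolding S_E_iff by metis
    fix e assume "e \<in> S_E s F \<kappa> S"
    then show "(x - (q + (1/2) *\<^sub>R v)) \<bullet> (e - (q + (1/2) *\<^sub>R v)) = 0"
      using S_H_orthogonal_S_E[OF _ footE yH qH, of e] unfolding x_E by (simp add: u_def inner_commute)
  qed
  have dist_E: "(infdist x (S_E s F \<kappa> S))\<^sup>2 = (norm u)\<^sup>2 / 4"
    unfolding infdist_E x_E by (simp add: power_divide)
  have "site_power p q = site_power p z - \<kappa> / 4 * (norm v)\<^sup>2"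
    using along_v[OF p, of 1] by (simp add: v_def)
  moreover have "p \<in> nearest z"
    using z p S_star_iff_subset_nearest[OF S_ne SA] by blast
  ultimately have value_q: "site_power p q = least_power z - \<kappa> / 4 * (norm v)\<^sup>2"
    by (simp add: least_power_nearest)
  have "(norm (y - z))\<^sup>2 = (norm (u - v))\<^sup>2" by (simp add: u_def v_def)
  also have "\<dots> = (norm u)\<^sup>2 + (norm v)\<^sup>2"
    using uv by (simp add: power2_norm_eq_inner inner_diff inner_commute)
  finally have dist_yz: "(norm (y - z))\<^sup>2 = (norm u)\<^sup>2 + (norm v)\<^sup>2" .
  have "real_of_ereal (d_set s F \<kappa> S q) = sg s * (least_power z - \<kappa> / 4 * (norm v)\<^sup>2)"
    using d_set_S_E[OF qE p] by (simp add: d_pt_eq_site_power value_q)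
  then show ?thesis
    unfolding x_def[symmetric] wells_piece_def q_def[symmetric] dist_H dist_E split_value_def dist_yz
    by (simp add: algebra_simps)
qed

section \<open>Wells' field and its \<open>\<Gamma>\<^sup>1\<close> on infinite sets\<close>

lemma wells_fun_eq_split_value:
  assumes "splitting x y z"
  shows "wells_fun s F A \<kappa> x = sg s * split_value y z"
  unfolding wells_fun_def
proof (rule the_equality)
  have value_eq: "wells_piece s F \<kappa> S x = sg s * split_value y z"
    if S: "S \<in> K_set s F A \<kappa>" "x \<in> T_cell s F A \<kappa> S" for S
  proof -
    obtain y' z' where yz': "y' \<in> S_hat s F \<kappa> S" "z' \<in> S_star s F A \<kappa> S"
        "x = (1/2) *\<^sub>R (y' + z')" "splitting x y' z'"
      using T_cell_splitting[OF S] .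
    then show ?thesis
      using wells_piece_eq_split_value[OF S(1) yz'(1,2)] split_value_unique[OF assms yz'(4)] by simp
  qed
  then show "\<exists>S\<in>K_set s F A \<kappa>. x \<in> T_cell s F A \<kappa> S \<and> sg s * split_value y z = wells_piece s F \<kappa> S x"
    using cells_cover[of x] by metis
  show "r = sg s * split_value y z"
    if "\<exists>S\<in>K_set s F A \<kappa>. x \<in> T_cell s F A \<kappa> S \<and> r = wells_piece s F \<kappa> S x" for r
    using that value_eq by blast
qed

lemma wells_fun_expansion:
  assumes "splitting x y z"
  shows "\<bar>wells_fun s F A \<kappa> x' - wells_fun s F A \<kappa> x - (sg s * (\<kappa> / 2)) *\<^sub>R (z - y) \<bullet> (x' - x)\<bar>
    \<le> \<kappa> / 2 * (norm (x' - x))\<^sup>2"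
proof -
  obtain y' z' where split': "splitting x' y' z'" using splitting_exists by blast
  have "\<bar>split_value y' z' - split_value y z - (\<kappa> / 2) *\<^sub>R (z - y) \<bullet> (x' - x)\<bar> \<le> \<kappa> / 2 * (norm (x' - x))\<^sup>2"
    using split_value_lower_bound[OF assms split'] split_value_upper_bound[OF assms split'] by linarith
  then show ?thesis
    unfolding wells_fun_eq_split_value[OF assms] wells_fun_eq_split_value[OF split']
    by (cases s) (simp_all add: abs_minus_commute algebra_simps)
qed

lemma wells_field_eq:
  assumes "splitting x y z"
  shows "wells_field s F A \<kappa> x = (sg s * split_value y z, (sg s * (\<kappa> / 2)) *\<^sub>R (z - y))"
  unfolding wells_field_def assoc_field_def
  by (simp add: wells_fun_eq_split_value[OF assms]
      gradient_eq[OF GDERIV_of_quadratic_bound[OF wells_fun_expansion[OF assms]]])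

lemma wells_field_quadratic_bound:
  "\<bar>wells_fun s F A \<kappa> b - field_poly (wells_field s F A \<kappa>) x b\<bar> \<le> \<kappa> / 2 * (norm (x - b))\<^sup>2"
proof -
  obtain y z where split: "splitting x y z" using splitting_exists by blast
  show ?thesis
    using wells_fun_expansion[OF split, of b]
    by (simp add: field_poly_def wells_field_eq[OF split] wells_fun_eq_split_value[OF split] norm_minus_commute algebra_simps)
qed

lemma Gamma1_wells_field_le: "Gamma1 (wells_field s F A \<kappa>) S \<le> ennreal \<kappa>"
proof (intro Gamma1_le Gamma1_at_le_of_quadratic_bound)
  show "\<kappa> \<ge> 0" using kappa_pos by simp
  fix x y b :: 'a
  show "\<bar>field_poly (wells_field s F A \<kappa>) x b - field_poly (wells_field s F A \<kappa>) y b\<bar>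
      \<le> \<kappa> / 2 * ((norm (x - b))\<^sup>2 + (norm (y - b))\<^sup>2)"
    using wells_field_quadratic_bound[of b x] wells_field_quadratic_bound[of b y]
    unfolding distrib_left by linarith
qed

text \<open>
  With \<open>z - z'\<close> orthogonal to \<open>y - y'\<close>, the vectors \<open>(z - z') - (y - y')\<close> and \<open>(z - z') + (y - y')\<close> have equal
  length; the first is \<open>2 / \<kappa>\<close> times the difference of the gradients up to sign, the second is
  \<open>2 *\<^sub>R (x - x')\<close>.
\<close>
lemma Gamma1_at_wells_field_same_cell:
  assumes S: "S \<in> K_set s F A \<kappa>" and x: "x \<in> T_cell s F A \<kappa> S" and x': "x' \<in> T_cell s F A \<kappa> S"
    and ne: "x \<noteq> x'"
  shows "ennreal \<kappa> \<le> Gamma1_at (wells_field s F A \<kappa>) x x'"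
proof -
  have SA: "S \<subseteq> A" using K_set_subset[OF S] by blast
  obtain y z where yz: "y \<in> S_hat s F \<kappa> S" "z \<in> S_star s F A \<kappa> S" "x = (1/2) *\<^sub>R (y + z)" "splitting x y z"
    using T_cell_splitting[OF S x] .
  obtain y' z' where yz': "y' \<in> S_hat s F \<kappa> S" "z' \<in> S_star s F A \<kappa> S" "x' = (1/2) *\<^sub>R (y' + z')" "splitting x' y' z'"
    using T_cell_splitting[OF S x'] .
  have "S_hat s F \<kappa> S \<subseteq> S_H s F \<kappa> S"
    unfolding S_hat_def S_H_def by (rule convex_hull_subset_affine_hull)
  then have perp: "(z - z') \<bullet> (y - y') = 0"
    using yz(1,2) yz'(1,2) S_star_subset_S_E[OF SA, of s F \<kappa>] by (intro S_H_orthogonal_S_E) blast+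
  let ?d = "snd (wells_field s F A \<kappa> x) - snd (wells_field s F A \<kappa> x')"
  have "?d = (sg s * (\<kappa> / 2)) *\<^sub>R ((z - z') - (y - y'))"
    by (simp add: wells_field_eq[OF yz(4)] wells_field_eq[OF yz'(4)] algebra_simps)
  then have "norm ?d = \<kappa> / 2 * norm ((z - z') - (y - y'))"
    using kappa_pos by (cases s) simp_all
  also have "norm ((z - z') - (y - y')) = norm ((z - z') + (y - y'))"
    using perp by (simp add: norm_eq inner_diff_left inner_diff_right inner_add_left inner_add_right inner_commute)
  also have "(z - z') + (y - y') = 2 *\<^sub>R (x - x')"
    by (simp add: yz(3) yz'(3) algebra_simps)
  finally have "norm ?d = \<kappa> * norm (x - x')" by simp
  then have "norm ?d / norm (x - x') = \<kappa>" using ne by simp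
  then show ?thesis using gradient_quotient_le_Gamma1_at[OF ne, of "wells_field s F A \<kappa>"] by simp
qed

lemma Gamma1_wells_field_infinite:
  assumes "infinite V"
  shows "Gamma1 (wells_field s F A \<kappa>) V = ennreal \<kappa>"
proof (rule antisym[OF Gamma1_wells_field_le])
  have "K_set s F A \<kappa> \<subseteq> Pow A" using K_set_subset by blast
  then have "finite (K_set s F A \<kappa>)" using finite_A by (meson finite_Pow_iff finite_subset)
  moreover have "V \<subseteq> (\<Union>S\<in>K_set s F A \<kappa>. V \<inter> T_cell s F A \<kappa> S)" using cells_cover by blast
  ultimately obtain S where S: "S \<in> K_set s F A \<kappa>" "infinite (V \<inter> T_cell s F A \<kappa> S)"
    using assms by (meson finite_UN_I finite_subset)
  then obtain x x' where "x \<in> V \<inter> T_cell s F A \<kappa> S" "x' \<in> V \<inter> T_cell s F A \<kappa> S" "x \<noteq> x'"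
    by (metis finite.emptyI finite_insert finite_subset insertCI subsetI)
  then show "ennreal \<kappa> \<le> Gamma1 (wells_field s F A \<kappa>) V"
    using Gamma1_at_wells_field_same_cell[OF S(1), of x x'] Gamma1_at_le_Gamma1[of x V x'] order_trans
    by (metis IntD1 IntD2)
qed

text \<open>
  The splitting of \<open>p \<in> A\<close> is the one with \<open>y\<close> the shifted point of \<open>p\<close> and \<open>z\<close> its reflection in \<open>p\<close>.  That \<open>p\<close> is
  nearest to \<open>z\<close> follows from the bound on \<open>\<Gamma>\<^sup>1(F; p, q)\<close>.
\<close>
lemma wells_field_interpolates:
  assumes "Gamma1 F A \<le> ennreal \<kappa>" and p: "p \<in> A"
  shows "wells_field s F A \<kappa> p = F p"
proof -
  define g where "g r = (sg s / \<kappa>) *\<^sub>R snd (F r)" for r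
  have shifted: "shifted_pt s F \<kappa> r = r - g r" for r
    by (simp add: g_def shifted_pt_def divide_inverse)
  have grad: "sg s *\<^sub>R snd (F r) = \<kappa> *\<^sub>R g r" for r
    using kappa_pos by (simp add: g_def)
  have jet: "sg s * field_poly F r b = sg s * fst (F r) + \<kappa> * (g r \<bullet> (b - r))" for r b
    using arg_cong[OF grad[of r], of "\<lambda>v. v \<bullet> (b - r)"] by (simp add: field_poly_def distrib_left)
  have power: "site_power r x = sg s * fst (F r) - \<kappa> / 2 * (norm (g r))\<^sup>2 + \<kappa> / 4 * (norm (x - (r - g r)))\<^sup>2" for r x
    using kappa_pos unfolding site_power_def shifted vertex_value_def
    by (simp add: g_def power_divide power2_eq_square)
  define z where "z = p + g p"
  have "site_power p z \<le> site_power q z" if q: "q \<in> A" for q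
  proof (cases "q = p")
    case False
    \<comment> \<open>This \<open>b\<close> is where the upper paraboloid of \<open>q\<close>, of vertex \<open>q - g q\<close>, comes closest to the lower paraboloid
      of \<open>p\<close>, of vertex \<open>z\<close>; the quadratic bound states exactly that the former lies above the latter.\<close>
    define b where "b = (1/2) *\<^sub>R (q - g q + z)"
    have "\<bar>field_poly F p b - field_poly F q b\<bar> \<le> \<kappa> / 2 * ((norm (p - b))\<^sup>2 + (norm (q - b))\<^sup>2)"
      using quadratic_bound_of_Gamma1_at[of F p q \<kappa> b] order_trans[OF Gamma1_at_le_Gamma1 assms(1), of p q]
        p q False kappa_pos by auto
    moreover have "sg s * field_poly F p b - sg s * field_poly F q b \<le> \<bar>field_poly F p b - field_poly F q b\<bar>"
      by (cases s) auto
    ultimately have "sg s * field_poly F p b - sg s * field_poly F q b \<le> \<kappa> / 2 * ((norm (p - b))\<^sup>2 + (norm (q - b))\<^sup>2)"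
      by linarith
    then show ?thesis
      unfolding jet power b_def z_def
      by (simp add: power2_norm_eq_inner inner_add inner_diff inner_commute algebra_simps
          add_divide_distrib diff_divide_distrib)
  qed simp
  then have "p \<in> nearest z" using p by (simp add: nearest_def)
  moreover have "p = (1/2) *\<^sub>R (p - g p + z)"
    by (simp add: z_def flip: scaleR_2)
  ultimately have split: "splitting p (p - g p) z" and least: "least_power z = site_power p z"
    using shifted[of p] by (auto simp: splitting_def least_power_nearest intro!: hull_inc image_eqI[of _ _ p])
  have diff: "z - (p - g p) = 2 *\<^sub>R g p"
    by (simp add: z_def scaleR_2)
  have "split_value (p - g p) z = sg s * fst (F p)"
    unfolding split_value_def least power norm_minus_commute[of "p - g p"] diff by simp
  moreover have "(sg s * (\<kappa> / 2)) *\<^sub>R (z - (p - g p)) = snd (F p)"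
    unfolding diff using kappa_pos by (cases s) (auto simp: g_def)
  ultimately show ?thesis
    by (simp add: wells_field_eq[OF split])
qed

section \<open>Absolute minimality\<close>

lemma is_AMLE_wells_field:
  assumes "DIM('a) \<ge> 2" and "F \<in> F1 A" and "Gamma1 F A = ennreal \<kappa>"
  shows "is_AMLE A UNIV F (wells_field s F A \<kappa>)"
proof -
  let ?W = "wells_field s F A \<kappa>"
  have infinite_V: "infinite V" if "open V" "V \<noteq> {}" for V :: "'a set"
    using that finite_imp_not_open by blast
  have total: "Gamma1 ?W V = ennreal \<kappa>" if "infinite V" for V
    using that by (rule Gamma1_wells_field_infinite)
  have "Gamma1 ?W UNIV = ennreal \<kappa>"
    using infinite_V[of UNIV] total by simp
  moreover have "\<forall>x\<in>A. field_poly ?W x = field_poly F x"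
    using assms(3) wells_field_interpolates by (simp add: field_poly_def fun_eq_iff)
  ultimately have "is_MLE A UNIV F ?W"
    using assms by (simp add: is_MLE_def F1_def)
  moreover have "Gamma1 ?W V = Gamma1 ?W (frontier V)" if "V \<noteq> {}" "bounded V" "open V" for V
    using that total infinite_V infinite_frontier[OF assms(1)] by metis
  ultimately show ?thesis by (auto simp: is_AMLE_def)
qed

end

theorem theorem28:
  fixes A :: "(real ^ 'n) set" and F :: "(real ^ 'n) field1" and \<kappa> :: real
  assumes "CARD('n) \<ge> 2"
    and "finite A"
    and "F \<in> F1 A"
    and "\<kappa> = enn2real (Gamma1 F A)"
    and "\<kappa> > 0"
  shows "is_AMLE A UNIV F (wells_field Upper F A \<kappa>) \<and> is_AMLE A UNIV F (wells_field Lower F A \<kappa>)"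
proof -
  have wells: "wells_construction A \<kappa>"
    using assms by unfold_locales (auto simp: F1_def)
  have "Gamma1 F A = ennreal \<kappa>"
    using assms(3,4) by (simp add: F1_def ennreal_enn2real)
  then have "is_AMLE A UNIV F (wells_field s F A \<kappa>)" for s
    using assms wells_construction.is_AMLE_wells_field[OF wells, of F s] by simp
  then show ?thesis by blast
qed

end
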